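(* Let $X$ be a locally convex Hausdorff topological vector space. Consider the generalized polyhedral convex set $$P=\big\{x\in X\;\big|\;\langle x_i^*,x\rangle\le\alpha_i\ \text{for all } i=1,\dots,m\big\}\cap L,$$ where $x_i^*\in X^*$, $\alpha_i\in\mathbb{R}$ for all $i=1,\dots,m$, and $L$ is a closed affine subspace of $X$. Suppose that $P$ is nonempty. Then $\mathrm{ri}\,P$ is nonempty and $$\mathrm{qri}\,P=\mathrm{iri}\,P=\mathrm{ri}\,P=\big\{x\in P\;\big|\;\langle x_i^*,x\rangle<\alpha_i\ \text{for all } i\in I\big\},$$ where $$I=\big\{i\in\{1,\dots,m\}\;\big|\;\exists\,\hat{x}_i\in P\ \text{such that } \langle x_i^*,\hat{x}_i\rangle<\alpha_i\big\}.$$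
   Context: All vector spaces are real. $X^*$ is the topological dual of $X$, $\langle x^*,x\rangle$ the value of $x^*\in X^*$ at $x\in X$, $\overline{\Omega}$ the topological closure of $\Omega$, $\mathrm{aff}\,\Omega$ the affine hull, and $\mathrm{cone}\,\Omega=\{t\omega\mid t\ge0,\ \omega\in\Omega\}$ the cone generated by $\Omega$. For $\Omega\subset X$: $\mathrm{ri}\,\Omega=\{a\in\Omega\mid \exists$ a neighborhood $V$ of the origin such that $(a+V)\cap\overline{\mathrm{aff}\,\Omega}\subset\Omega\}$ (relative interior); $\mathrm{iri}\,\Omega=\{a\in\Omega\mid \mathrm{cone}(\Omega-a)$ is a linear subspace of $X\}$ (intrinsic relative interior); $\mathrm{qri}\,\Omega=\{a\in\Omega\mid \overline{\mathrm{cone}(\Omega-a)}$ is a linear subspace of $X\}$ (quasi-relative interior). *)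

theory Defs
  imports "HOL-Analysis.Analysis"
begin

class topological_real_vector = real_vector + topological_ab_group_add +
  assumes tendsto_scaleR_Pair:
    "filterlim (\<lambda>p. fst p *\<^sub>R snd p) (nhds (c *\<^sub>R x)) (nhds (c::real) \<times>\<^sub>F nhds x)"

text \<open>
  The origin has a neighbourhood base of convex sets. Convexity and interior are unfolded
  because a class specification can only use constants available in its superclasses; see
  \<open>convex_neighbourhood_zero\<close> for the folded form.
\<close>

class locally_convex_space = topological_real_vector +
  assumes ex_convex_neighbourhood_zero:
    "open U \<Longrightarrow> 0 \<in> U \<Longrightarrow>
      \<exists>V W. open W \<and> 0 \<in> W \<and> W \<subseteq> V \<and> V \<subseteq> U \<and>
        (\<forall>x\<in>V. \<forall>y\<in>V. \<forall>u\<ge>0. \<forall>v\<ge>0. u + v = (1::real) \<longrightarrow> u *\<^sub>R x + v *\<^sub>R y \<in> V)"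

lemma convex_neighbourhood_zero:
  fixes U :: "'a::locally_convex_space set"
  assumes "open U" "0 \<in> U"
  shows "\<exists>V. convex V \<and> 0 \<in> interior V \<and> V \<subseteq> U"
  using ex_convex_neighbourhood_zero[OF assms] unfolding convex_def interior_def by blast

instance real_normed_vector \<subseteq> locally_convex_space
proof
  fix c :: real and x :: 'a
  show "filterlim (\<lambda>p. fst p *\<^sub>R snd p) (nhds (c *\<^sub>R x)) (nhds c \<times>\<^sub>F nhds x)"
    by (intro tendsto_scaleR filterlim_fst filterlim_snd)
next
  fix U :: "'a set"
  assume "open U" "0 \<in> U"
  then obtain e where "e > 0" "ball 0 e \<subseteq> U"
    using open_contains_ball by blast
  moreover have "convex (ball (0::'a) e)"
    by (rule convex_ball)
  ultimately show "\<exists>V W. open W \<and> 0 \<in> W \<and> W \<subseteq> V \<and> V \<subseteq> U \<and>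
        (\<forall>x\<in>V. \<forall>y\<in>V. \<forall>u\<ge>0. \<forall>v\<ge>0. u + v = (1::real) \<longrightarrow> u *\<^sub>R x + v *\<^sub>R y \<in> V)"
    unfolding convex_def
    by (intro exI[of _ "ball 0 e"] conjI) (auto simp del: mem_ball_0)
qed

definition topological_dual :: "('a::topological_real_vector \<Rightarrow> real) set" where
  "topological_dual = {f. linear f \<and> continuous_on UNIV f}"

text \<open>
  Unlike the library's \<^const>\<open>rel_interior\<close>, the following relative interior is taken
  with respect to the closure of the affine hull; in infinite dimensions the two differ.
  A neighbourhood \<open>V\<close> of the origin is a set with \<open>0 \<in> interior V\<close>; it need not be open.
\<close>

definition ri :: "'a::topological_real_vector set \<Rightarrow> 'a set" where
  "ri S = {a \<in> S. \<exists>V. 0 \<in> interior V \<and> (\<lambda>v. a + v) ` V \<inter> closure (affine hull S) \<subseteq> S}"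

text \<open>
  By \<open>cone_hull_expl\<close>, \<^term>\<open>cone hull S\<close> is the set of all \<open>t *\<^sub>R w\<close> with \<open>t \<ge> 0\<close>
  and \<open>w \<in> S\<close>; no convexification is involved.
\<close>

definition iri :: "'a::topological_real_vector set \<Rightarrow> 'a set" where
  "iri S = {a \<in> S. subspace (cone hull ((\<lambda>x. x - a) ` S))}"

definition qri :: "'a::topological_real_vector set \<Rightarrow> 'a set" where
  "qri S = {a \<in> S. subspace (closure (cone hull ((\<lambda>x. x - a) ` S)))}"

end

theory Submission
  imports Defs
begin

text \<open>
  Write \<open>R\<close> for the set of points of \<open>P\<close> at which every constraint with an index in \<open>I\<close> is
  strict. The three relative interiors agree with \<open>R\<close> because of the cycle
  \<open>R \<subseteq> ri P \<subseteq> iri P \<subseteq> qri P \<subseteq> R\<close>, whose two middle inclusions hold for arbitrary sets.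

  The constraints with an index outside \<open>I\<close> hold with equality on all of \<open>P\<close>. Together with
  \<open>L\<close> they therefore cut out a closed affine set that contains \<open>P\<close>, hence also the closure of its
  affine hull; on this set membership in \<open>P\<close> only depends on the finitely many constraints
  in \<open>I\<close>. Near a point of \<open>R\<close> these remain strict by continuity, so \<open>R \<subseteq> ri P\<close>
  (\<open>strict_imp_ri\<close>).

  A point of the relative interior can be moved a little way in every direction of the affine hull
  without leaving the set, so the cone at that point is the whole direction space of the affine
  hull (\<open>ri_subset_iri\<close>). The closure of a subspace is a subspace (\<open>iri_subset_qri\<close>).

  Finally, a continuous linear functional that attains its maximum over a set at a quasi-relative
  interior point is constant on the set, since it is nonpositive on the closed cone at that point
  and this closed cone is a linear subspace (\<open>qri_maximizer_imp_constant\<close>). A constraint in \<open>I\<close> is not constant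
  equal to its bound on \<open>P\<close>, so it is strict at every point of \<open>qri P\<close>.

  That \<open>R\<close>, and with it \<open>ri P\<close>, is nonempty follows by taking midpoints of witnesses for the
  individual constraints (\<open>convex_simultaneously_strict\<close>).
\<close>

lemma tendsto_scaleR_topological:
  fixes g :: "'b \<Rightarrow> 'a::topological_real_vector"
  assumes "(f \<longlongrightarrow> c) F" "(g \<longlongrightarrow> x) F"
  shows "((\<lambda>z. f z *\<^sub>R g z) \<longlongrightarrow> c *\<^sub>R x) F"
  using filterlim_compose[OF tendsto_scaleR_Pair filterlim_Pair[OF assms]] by simp

lemma continuous_on_scaleR_topological:
  fixes g :: "'b::topological_space \<Rightarrow> 'a::topological_real_vector"
  assumes "continuous_on A f" "continuous_on A g"
  shows "continuous_on A (\<lambda>z. f z *\<^sub>R g z)"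
  using assms by (simp add: continuous_on_def tendsto_scaleR_topological)

lemma subspace_closure_topological:
  fixes S :: "'a::topological_real_vector set"
  assumes S: "subspace S"
  shows "subspace (closure S)"
proof (rule subspaceI)
  show "0 \<in> closure S"
    using S closure_subset subspace_0 by blast
next
  fix c :: real and x
  assume x: "x \<in> closure S"
  have "(\<lambda>z. c *\<^sub>R z) ` closure S \<subseteq> closure S"
  proof (rule image_closure_subset)
    show "continuous_on (closure S) (\<lambda>z. c *\<^sub>R z)"
      by (intro continuous_on_scaleR_topological continuous_intros)
    show "(\<lambda>z. c *\<^sub>R z) ` S \<subseteq> closure S"
      using subspace_scale[OF S] closure_subset by blast
  qed simp
  with x show "c *\<^sub>R x \<in> closure S" by blast
next
  fix x y
  assume xy: "x \<in> closure S" "y \<in> closure S"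
  \<comment> \<open>The closure is reached in one summand at a time, so only translations need to be continuous.\<close>
  have one: "s + z \<in> closure S" if "s \<in> S" "z \<in> closure S" for s z
  proof -
    have "(\<lambda>z. s + z) ` closure S \<subseteq> closure S"
    proof (rule image_closure_subset)
      show "continuous_on (closure S) (\<lambda>z. s + z)"
        by (intro continuous_intros)
      show "(\<lambda>z. s + z) ` S \<subseteq> closure S"
        using subspace_add[OF S that(1)] closure_subset by blast
    qed simp
    with that show ?thesis by blast
  qed
  have "(\<lambda>z. z + y) ` closure S \<subseteq> closure S"
  proof (rule image_closure_subset)
    show "continuous_on (closure S) (\<lambda>z. z + y)"
      by (intro continuous_intros)
    show "(\<lambda>z. z + y) ` S \<subseteq> closure S"
      using one xy by blast
  qed simp
  with xy show "x + y \<in> closure S" by blast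
qed

text \<open>By continuity of scalar multiplication, \<open>t *\<^sub>R v\<close> tends to \<open>0\<close> as \<open>t\<close> decreases to \<open>0\<close>.\<close>

lemma neighbourhood_zero_absorbs:
  fixes v :: "'a::topological_real_vector"
  assumes "0 \<in> interior V"
  obtains t :: real where "t > 0" "t *\<^sub>R v \<in> V"
proof -
  have "((\<lambda>t. t *\<^sub>R v) \<longlongrightarrow> 0 *\<^sub>R v) (at_right (0::real))"
    by (intro tendsto_scaleR_topological tendsto_ident_at tendsto_const)
  then have "\<forall>\<^sub>F t in at_right (0::real). t *\<^sub>R v \<in> interior V"
    using assms by (simp add: tendsto_def)
  then have "\<forall>\<^sub>F t in at_right (0::real). t > 0 \<and> t *\<^sub>R v \<in> interior V"
    using eventually_at_right_less[of "0::real"] by eventually_elim auto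
  then obtain t :: real where "t > 0" "t *\<^sub>R v \<in> interior V"
    by (metis (mono_tags, lifting) eventually_happens trivial_limit_at_right_real)
  then show thesis
    using that interior_subset by blast
qed

text \<open>
  At a relative interior point, the absorbing neighbourhood reaches \<open>S\<close> along every direction of
  the affine hull. The cone is therefore the direction space of the affine hull.
\<close>

lemma ri_subset_iri:
  fixes S :: "'a::topological_real_vector set"
  shows "ri S \<subseteq> iri S"
proof
  fix a assume "a \<in> ri S"
  then obtain V where a: "a \<in> S" and V: "0 \<in> interior V"
    and sub: "(\<lambda>v. a + v) ` V \<inter> closure (affine hull S) \<subseteq> S"
    unfolding ri_def by blast
  let ?D = "(\<lambda>x. x - a) ` (affine hull S)"
  have D: "subspace ?D"
    by (intro affine_diffs_subspace_subtract affine_affine_hull hull_inc a)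
  have "cone hull ((\<lambda>x. x - a) ` S) = ?D"
  proof
    show "cone hull ((\<lambda>x. x - a) ` S) \<subseteq> ?D"
      by (rule hull_minimal)
        (use D in \<open>auto simp: subspace_imp_cone intro: hull_inc\<close>)
  next
    show "?D \<subseteq> cone hull ((\<lambda>x. x - a) ` S)"
    proof
      fix v assume v: "v \<in> ?D"
      obtain t where t: "t > 0" "t *\<^sub>R v \<in> V"
        using neighbourhood_zero_absorbs[OF V] .
      have "t *\<^sub>R v \<in> ?D"
        using D v by (rule subspace_scale)
      then have "a + t *\<^sub>R v \<in> affine hull S"
        by auto
      then have "a + t *\<^sub>R v \<in> S"
        using sub t(2) closure_subset by blast
      then have "t *\<^sub>R v \<in> (\<lambda>x. x - a) ` S"
        by (rule rev_image_eqI) simp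
      then have "(1 / t) *\<^sub>R (t *\<^sub>R v) \<in> cone hull ((\<lambda>x. x - a) ` S)"
        by (intro mem_cone[OF cone_cone_hull] hull_inc) (use t in auto)
      then show "v \<in> cone hull ((\<lambda>x. x - a) ` S)"
        using t by simp
    qed
  qed
  then show "a \<in> iri S"
    using a D unfolding iri_def by simp
qed

lemma iri_subset_qri:
  fixes S :: "'a::topological_real_vector set"
  shows "iri S \<subseteq> qri S"
  unfolding iri_def qri_def using subspace_closure_topological by blast

text \<open>
  Quasi-relative interior points are not properly supported: \<open>f \<le> 0\<close> on the closed cone at
  the maximizer \<open>a\<close>, and this closed cone also contains the negatives of its elements.
\<close>

lemma qri_maximizer_imp_constant:
  fixes f :: "'a::topological_real_vector \<Rightarrow> real"
  assumes a: "a \<in> qri S" and f: "f \<in> topological_dual"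
    and max: "\<And>x. x \<in> S \<Longrightarrow> f x \<le> f a" and y: "y \<in> S"
  shows "f y = f a"
proof -
  interpret linear f
    using f by (simp add: topological_dual_def)
  have cont: "continuous_on A f" for A
    using f continuous_on_subset unfolding topological_dual_def by blast
  let ?K = "closure (cone hull ((\<lambda>x. x - a) ` S))"
  have K: "subspace ?K"
    using a by (simp add: qri_def)
  have "f ` ?K \<subseteq> {..0}"
  proof (rule image_closure_subset)
    show "f ` (cone hull ((\<lambda>x. x - a) ` S)) \<subseteq> {..0}"
      using max by (auto simp: cone_hull_expl scale diff mult_nonneg_nonpos)
  qed (auto intro: cont)
  moreover have ya: "y - a \<in> ?K"
    using y by (intro subsetD[OF closure_subset] hull_inc) simp
  moreover have "- (y - a) \<in> ?K"
    using K ya by (rule subspace_neg)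
  ultimately have "f (y - a) \<le> 0" "f (- (y - a)) \<le> 0"
    by blast+
  then show ?thesis
    by (simp add: diff)
qed

text \<open>
  In the midpoint of two points satisfying the constraints, a constraint is strict as soon as it is
  strict at one of them; so strict constraints can be collected one at a time.
\<close>

lemma convex_simultaneously_strict:
  fixes f :: "'i \<Rightarrow> 'a::real_vector \<Rightarrow> real"
  assumes "finite J" "convex P" "P \<noteq> {}"
    and lin: "\<And>i. i \<in> J \<Longrightarrow> linear (f i)"
    and le: "\<And>i x. i \<in> J \<Longrightarrow> x \<in> P \<Longrightarrow> f i x \<le> b i"
    and strict: "\<And>i. i \<in> J \<Longrightarrow> \<exists>x\<in>P. f i x < b i"
  shows "\<exists>x\<in>P. \<forall>i\<in>J. f i x < b i"
  using assms(1) lin le strict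
proof (induction J)
  case empty
  then show ?case using \<open>P \<noteq> {}\<close> by blast
next
  case (insert j J)
  obtain x where x: "x \<in> P" "\<forall>i\<in>J. f i x < b i"
    using insert.IH insert.prems by auto
  obtain y where y: "y \<in> P" "f j y < b j"
    using insert.prems(3) by blast
  let ?z = "(1/2) *\<^sub>R x + (1/2) *\<^sub>R y"
  have "f i ?z < b i" if i: "i \<in> insert j J" for i
  proof -
    have mid: "f i ?z = (f i x + f i y) / 2"
      using insert.prems(1)[OF i] by (simp add: linear_add linear_scale)
    have "f i x \<le> b i" "f i y \<le> b i"
      using insert.prems(2)[OF i] x y by auto
    moreover have "f i x < b i \<or> f i y < b i"
      using i x y by auto
    ultimately have "(f i x + f i y) / 2 < b i"
      by (auto simp: field_simps)
    then show ?thesis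
      by (simp only: mid)
  qed
  moreover have "?z \<in> P"
    using \<open>convex P\<close> x y by (simp add: convexD)
  ultimately show ?case by blast
qed

lemma affine_linear_level_set:
  fixes f :: "'a::real_vector \<Rightarrow> real"
  assumes "linear f"
  shows "affine {x. f x = b}"
  unfolding affine_def
  by (auto simp: linear_add[OF assms] linear_scale[OF assms] simp flip: distrib_right)

lemma convex_linear_sublevel_set:
  fixes f :: "'a::real_vector \<Rightarrow> real"
  assumes "linear f"
  shows "convex {x. f x \<le> b}"
  using convex_linear_vimage[OF assms convex_real_interval(2)[of b]] by (simp add: vimage_def)

text \<open>
  The tight constraints and \<open>L\<close> together define a closed affine set, which bounds the closure of the
  affine hull of \<open>P\<close>. Inside it only the finitely many strict inequalities at \<open>a\<close> matter, and
  these define an open neighbourhood of \<open>a\<close>.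
\<close>

lemma strict_imp_ri:
  fixes f :: "'i \<Rightarrow> 'a::topological_real_vector \<Rightarrow> real"
  assumes "finite J" and dual: "\<And>i. i \<in> J \<union> E \<Longrightarrow> f i \<in> topological_dual"
    and L: "affine L" "closed L"
    and P: "P = {x. \<forall>i\<in>J \<union> E. f i x \<le> b i} \<inter> L"
    and tight: "\<And>i x. i \<in> E \<Longrightarrow> x \<in> P \<Longrightarrow> f i x = b i"
    and a: "a \<in> P" "\<And>i. i \<in> J \<Longrightarrow> f i a < b i"
  shows "a \<in> ri P"
proof -
  have lin: "linear (f i)" and cont: "continuous_on UNIV (f i)" if "i \<in> J \<union> E" for i
    using dual[OF that] by (auto simp: topological_dual_def)
  let ?M = "(\<Inter>i\<in>E. {x. f i x = b i}) \<inter> L"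
  have "affine ?M"
    using L(1) lin by (auto intro!: affine_Int affine_Inter affine_linear_level_set)
  moreover have "closed ?M"
    using L(2) cont by (intro closed_Int closed_INT ballI closed_Collect_eq) auto
  moreover have "P \<subseteq> ?M"
    using tight P by auto
  ultimately have hull: "closure (affine hull P) \<subseteq> ?M"
    by (intro closure_minimal hull_minimal)
  define V where "V = (\<Inter>i\<in>J. {v. f i v < b i - f i a})"
  have "open V"
    unfolding V_def using \<open>finite J\<close> cont
    by (intro open_INT ballI open_Collect_less) auto
  moreover have "0 \<in> V"
    unfolding V_def using a(2) lin by (auto simp: linear_0)
  moreover have "(\<lambda>v. a + v) ` V \<inter> ?M \<subseteq> P"
  proof safe
    fix v assume v: "v \<in> V" and M: "a + v \<in> (\<Inter>i\<in>E. {x. f i x = b i})" "a + v \<in> L"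
    have "f i (a + v) \<le> b i" if "i \<in> J" for i
      using v that lin[of i] by (force simp: V_def linear_add)
    then show "a + v \<in> P"
      unfolding P using M by auto
  qed
  ultimately show ?thesis
    unfolding ri_def using a(1) hull by (auto simp: interior_open intro!: exI[of _ V])
qed

theorem theorem5p1:
  fixes m :: nat
    and xs :: "nat \<Rightarrow> 'a::{locally_convex_space, t2_space} \<Rightarrow> real"
    and \<alpha> :: "nat \<Rightarrow> real"
    and L P :: "'a set"
    and I :: "nat set"
  assumes dual: "\<And>i. i \<in> {1..m} \<Longrightarrow> xs i \<in> topological_dual"
    and L: "affine L" "closed L"
    and P: "P = {x. \<forall>i\<in>{1..m}. xs i x \<le> \<alpha> i} \<inter> L"
    and nonempty: "P \<noteq> {}"
    and I: "I = {i \<in> {1..m}. \<exists>y\<in>P. xs i y < \<alpha> i}"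
  shows "ri P \<noteq> {} \<and>
         qri P = iri P \<and> iri P = ri P \<and>
         ri P = {x \<in> P. \<forall>i\<in>I. xs i x < \<alpha> i}"
proof -
  let ?R = "{x \<in> P. \<forall>i\<in>I. xs i x < \<alpha> i}"
  have lin: "linear (xs i)" if "i \<in> {1..m}" for i
    using dual[OF that] by (simp add: topological_dual_def)
  have I_sub: "I \<subseteq> {1..m}" and "finite I"
    unfolding I by auto
  have le: "xs i x \<le> \<alpha> i" if "i \<in> {1..m}" "x \<in> P" for i x
    using that P by auto
  have "P = (\<Inter>i\<in>{1..m}. {x. xs i x \<le> \<alpha> i}) \<inter> L"
    unfolding P by auto
  moreover have "convex (\<Inter>i\<in>{1..m}. {x. xs i x \<le> \<alpha> i})"
    using lin by (intro convex_INT convex_linear_sublevel_set)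
  ultimately have "convex P"
    using convex_Int affine_imp_convex[OF L(1)] by metis
  have "\<exists>x\<in>P. \<forall>i\<in>I. xs i x < \<alpha> i"
  proof (rule convex_simultaneously_strict[OF \<open>finite I\<close> \<open>convex P\<close> nonempty])
    show "\<exists>x\<in>P. xs i x < \<alpha> i" if "i \<in> I" for i
      using that unfolding I by blast
  qed (use I_sub lin le in blast)+
  then have "?R \<noteq> {}" by blast
  moreover have "?R \<subseteq> ri P"
  proof
    fix a assume a: "a \<in> ?R"
    have split: "I \<union> ({1..m} - I) = {1..m}"
      using I_sub by blast
    show "a \<in> ri P"
    proof (rule strict_imp_ri[OF \<open>finite I\<close> _ L, where E = "{1..m} - I"])
      show "xs i x = \<alpha> i" if "i \<in> {1..m} - I" "x \<in> P" for i x
        using that le[of i x] unfolding I by force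
    qed (use a dual P in \<open>simp_all only: split mem_Collect_eq\<close>)
  qed
  moreover have "qri P \<subseteq> ?R"
  proof
    fix a assume a: "a \<in> qri P"
    then have "a \<in> P" by (simp add: qri_def)
    moreover have "xs i a < \<alpha> i" if i: "i \<in> I" for i
    proof (rule ccontr)
      assume "\<not> xs i a < \<alpha> i"
      then have eq: "xs i a = \<alpha> i"
        using le[of i a] i I_sub \<open>a \<in> P\<close> by auto
      obtain y where y: "y \<in> P" "xs i y < \<alpha> i"
        using i I by blast
      have "xs i y = xs i a"
        using a by (rule qri_maximizer_imp_constant) (use i I_sub dual le eq y in auto)
      with y eq show False by simp
    qed
    ultimately show "a \<in> ?R" by blast
  qed
  ultimately show ?thesis
    using ri_subset_iri[of P] iri_subset_qri[of P] by blast
qed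

end
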